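(* Let $s\geq t\geq 2$ be integers. If $G$ is an $r$-regular graph with $H=K_{t,s}$ as a star complement for the eigenvalue $-1$, then $r\equiv -1 \pmod{\frac{ts-1}{\gcd(s-1,t-1)}}$ and $G\cong G(r)$, where $G(r)$ is the graph defined as follows. Let $H=K_{t,s}$ have bipartition $(V,W)$ with $V=\{v_1,\dots,v_t\}$, $W=\{w_1,\dots,w_s\}$. The vertex set of $G(r)$ is $V\cup W\cup X$ with $X=V_1\cup\cdots\cup V_t\cup W_1\cup\cdots\cup W_s$ (disjoint), where $|V_i|=\frac{(r+1)(s-1)}{ts-1}-1$ for $1\le i\le t$ and $|W_j|=\frac{(r+1)(t-1)}{ts-1}-1$ for $1\le j\le s$. The edges are: all edges of $K_{t,s}$ between $V$ and $W$; each vertex of $V_i$ is adjacent to $v_i$ and to all vertices of $W$ (and to no other vertex of $V$); each vertex of $W_j$ is adjacent to $w_j$ and to all vertices of $V$ (and to no other vertex of $W$); each $V_i$ and each $W_j$ induces a clique; every vertex of $V_i$ is adjacent to every vertex of $W_j$ for all $i,j$; there are no edges between $V_i$ and $V_{i'}$ for $i\neq i'$, nor between $W_j$ and $W_{j'}$ for $j\ne j'$.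
   Context: All graphs are finite and simple; eigenvalues are eigenvalues of the adjacency matrix. If $\mu$ is an eigenvalue of a graph $G$ with multiplicity $k\geq 1$, a star set for $\mu$ in $G$ is a vertex subset $X\subseteq V(G)$ with $|X|=k$ such that $\mu$ is not an eigenvalue of the induced subgraph $G-X$; $H=G-X$ is then a star complement for $\mu$. "$G$ has $K_{t,s}$ as a star complement for $\mu$" means some star set $X$ for $\mu$ satisfies $G-X\cong K_{t,s}$. *)

theory Defs
  imports
    "Graph_Theory.Graph_Theory"
    "Jordan_Normal_Form.Char_Poly"
    "Jordan_Normal_Form.Matrix_Kernel"
    "HOL-Number_Theory.Cong"
begin

text \<open>
  A finite simple graph is a \<open>graph\<close> of the entry Graph-Theory: a finite, loop-free digraph
  without parallel arcs whose adjacency relation is symmetric.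
\<close>

section \<open>Spectrum and star sets\<close>

text \<open>
  The adjacency matrix needs an ordering of the vertices. One is chosen arbitrarily; another choice
  conjugates the matrix by a permutation matrix.
\<close>

definition vertex_enum :: "('a, 'b) pre_digraph \<Rightarrow> 'a list" where
  "vertex_enum G = (SOME xs. distinct xs \<and> set xs = verts G)"

definition adjacency_matrix :: "('a, 'b) pre_digraph \<Rightarrow> real mat" where
  "adjacency_matrix G =
     (let xs = vertex_enum G in
      mat (length xs) (length xs) (\<lambda>(i, j). if xs ! i \<rightarrow>\<^bsub>G\<^esub> xs ! j then 1 else 0))"

definition graph_eigenvalue :: "('a, 'b) pre_digraph \<Rightarrow> real \<Rightarrow> bool" where
  "graph_eigenvalue G \<mu> \<longleftrightarrow> eigenvalue (adjacency_matrix G) \<mu>"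

text \<open>
  The multiplicity is the dimension of the eigenspace, i.e. of the kernel of \<open>A - \<mu> I\<close>. As the
  adjacency matrix is real symmetric, there is no distinction from the algebraic multiplicity.
\<close>

definition eigenvalue_multiplicity :: "('a, 'b) pre_digraph \<Rightarrow> real \<Rightarrow> nat" where
  "eigenvalue_multiplicity G \<mu> = kernel_dim (char_matrix (adjacency_matrix G) \<mu>)"

definition star_set :: "('a, 'b) pre_digraph \<Rightarrow> real \<Rightarrow> 'a set \<Rightarrow> bool" where
  "star_set G \<mu> X \<longleftrightarrow>
     graph_eigenvalue G \<mu> \<and> X \<subseteq> verts G \<and> card X = eigenvalue_multiplicity G \<mu> \<and>
     \<not> graph_eigenvalue (G \<restriction> (verts G - X)) \<mu>"

definition has_bipartite_star_complement ::
  "('a, 'b) pre_digraph \<Rightarrow> nat \<Rightarrow> nat \<Rightarrow> real \<Rightarrow> bool" where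
  "has_bipartite_star_complement G t s \<mu> \<longleftrightarrow>
     (\<exists>X. star_set G \<mu> X \<and> K\<^bsub>t,s\<^esub> (G \<restriction> (verts G - X)))"

text \<open>In a simple graph, the out-degree of a vertex is its number of neighbours.\<close>

definition regular_graph :: "nat \<Rightarrow> ('a, 'b) pre_digraph \<Rightarrow> bool" where
  "regular_graph r G \<longleftrightarrow> (\<forall>v \<in> verts G. out_degree G v = r)"


section \<open>The graph \<open>G(r)\<close>\<close>

text \<open>
  \<open>VertV i\<close> is $v_i$ and \<open>VertW j\<close> is $w_j$; \<open>ExtraV i k\<close> is the \<open>k\<close>-th element of $V_i$
  and \<open>ExtraW j k\<close> the \<open>k\<close>-th element of $W_j$.
\<close>

datatype gr_vertex = VertV nat | VertW nat | ExtraV nat nat | ExtraW nat nat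

text \<open>
  The cardinalities of the $V_i$ and $W_j$. The division is exact and the outer subtraction does not
  truncate when \<open>r\<close> lies in the required residue class, see the lemma \<open>size_V_W_exact\<close> below.
\<close>

definition size_V :: "nat \<Rightarrow> nat \<Rightarrow> nat \<Rightarrow> nat" where
  "size_V t s r = ((r + 1) * (s - 1)) div (t * s - 1) - 1"

definition size_W :: "nat \<Rightarrow> nat \<Rightarrow> nat \<Rightarrow> nat" where
  "size_W t s r = ((r + 1) * (t - 1)) div (t * s - 1) - 1"

definition side_V :: "nat \<Rightarrow> gr_vertex set" where
  "side_V t = VertV ` {1..t}"

definition side_W :: "nat \<Rightarrow> gr_vertex set" where
  "side_W s = VertW ` {1..s}"

definition class_V :: "nat \<Rightarrow> nat \<Rightarrow> nat \<Rightarrow> nat \<Rightarrow> gr_vertex set" where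
  "class_V t s r i = ExtraV i ` {1..size_V t s r}"

definition class_W :: "nat \<Rightarrow> nat \<Rightarrow> nat \<Rightarrow> nat \<Rightarrow> gr_vertex set" where
  "class_W t s r j = ExtraW j ` {1..size_W t s r}"

text \<open>Each edge is listed in at least one orientation; the arc set below adds the reverses.\<close>

definition gr_edges :: "nat \<Rightarrow> nat \<Rightarrow> nat \<Rightarrow> gr_vertex rel" where
  "gr_edges t s r =
     side_V t \<times> side_W s
     \<union> (\<Union>i\<in>{1..t}. class_V t s r i \<times> ({VertV i} \<union> side_W s))
     \<union> (\<Union>j\<in>{1..s}. class_W t s r j \<times> ({VertW j} \<union> side_V t))
     \<union> (\<Union>i\<in>{1..t}. class_V t s r i \<times> class_V t s r i - Id)
     \<union> (\<Union>j\<in>{1..s}. class_W t s r j \<times> class_W t s r j - Id)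
     \<union> (\<Union>i\<in>{1..t}. \<Union>j\<in>{1..s}. class_V t s r i \<times> class_W t s r j)"

definition gr_graph :: "nat \<Rightarrow> nat \<Rightarrow> nat \<Rightarrow> gr_vertex pair_pre_digraph" where
  "gr_graph t s r =
     \<lparr> pverts = side_V t \<union> side_W s
         \<union> (\<Union>i\<in>{1..t}. class_V t s r i) \<union> (\<Union>j\<in>{1..s}. class_W t s r j),
       parcs = gr_edges t s r \<union> (gr_edges t s r)\<inverse> \<rparr>"

lemma size_exact_aux:
  fixes s t r :: nat and m :: int
  assumes "2 \<le> t" "2 \<le> s"
    and cong: "[int r = -1] (mod ((int t * int s - 1) div gcd (int s - 1) (int t - 1)))"
    and m: "m > 0" "gcd (int s - 1) (int t - 1) dvd m"
  obtains k where "k > 0" "(int r + 1) * m = int k * (int t * int s - 1)"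
proof -
  define g where "g = gcd (int s - 1) (int t - 1)"
  have "int t * int s - 1 = int t * (int s - 1) + (int t - 1)"
    by (simp add: algebra_simps)
  then have "g dvd int t * int s - 1"
    unfolding g_def by (metis dvd_add dvd_mult gcd_dvd1 gcd_dvd2)
  then obtain d where d: "int t * int s - 1 = g * d" ..
  obtain q where q: "m = g * q" using m(2) unfolding g_def ..
  have g0: "g > 0" using assms(1) by (simp add: g_def gcd_pos_int)
  have "(int t * int s - 1) div g = d" using d g0 by simp
  then have "d dvd int r + 1"
    using cong by (simp add: g_def cong_iff_dvd_diff)
  then obtain c where c: "int r + 1 = d * c" ..
  have eq: "(int r + 1) * m = (c * q) * (int t * int s - 1)"
    unfolding d q c by (simp add: algebra_simps)
  have "int t * int s - 1 > 0"
    using mult_mono[of 2 "int t" 2 "int s"] assms(1,2) by simp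
  moreover have "(int r + 1) * m > 0" using m(1) by simp
  ultimately have "c * q > 0" using eq by (metis zero_less_mult_pos2)
  with eq show ?thesis by (intro that[of "nat (c * q)"]) auto
qed

lemma size_V_W_exact:
  fixes s t r :: nat
  assumes "2 \<le> t" "2 \<le> s"
    and "[int r = -1] (mod ((int t * int s - 1) div gcd (int s - 1) (int t - 1)))"
  shows "real (size_V t s r) = (real r + 1) * (real s - 1) / (real t * real s - 1) - 1"
    and "real (size_W t s r) = (real r + 1) * (real t - 1) / (real t * real s - 1) - 1"
proof -
  have *: "real ((r + 1) * (u - 1) div (t * s - 1) - 1)
      = (real r + 1) * (real u - 1) / (real t * real s - 1) - 1"
    if u: "2 \<le> u" and dvd: "gcd (int s - 1) (int t - 1) dvd int u - 1" for u
  proof -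
    have "int u - 1 > 0" using u by simp
    from size_exact_aux[OF assms this dvd] obtain k
      where k: "k > 0" "(int r + 1) * (int u - 1) = int k * (int t * int s - 1)" by blast
    have pos: "t * s > 1" using mult_le_mono[OF assms(1,2)] by simp
    have le: "1 \<le> u" "1 \<le> t * s" using u pos by linarith+
    have u': "int (u - 1) = int u - 1" and ts': "int (t * s - 1) = int t * int s - 1"
      using le by (simp_all only: of_nat_diff of_nat_mult of_nat_1)
    have "int ((r + 1) * (u - 1)) = (int r + 1) * (int u - 1)"
      unfolding of_nat_mult u' by simp
    also have "\<dots> = int (k * (t * s - 1))"
      unfolding of_nat_mult ts' by (simp add: k(2))
    finally have eq: "(r + 1) * (u - 1) = k * (t * s - 1)"
      by (simp only: of_nat_eq_iff)
    have u'': "real (u - 1) = real u - 1" and ts'': "real (t * s - 1) = real t * real s - 1"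
      using le by (simp_all only: of_nat_diff of_nat_mult of_nat_1)
    have "real (r + 1) * real (u - 1) = real k * real (t * s - 1)"
      using eq by (metis of_nat_mult)
    then have "(real r + 1) * (real u - 1) = real k * (real t * real s - 1)"
      unfolding u'' ts'' by (simp add: add.commute)
    moreover have "real t * real s - 1 \<noteq> 0"
      unfolding ts''[symmetric] using pos by simp
    ultimately have "(real r + 1) * (real u - 1) / (real t * real s - 1) = real k"
      by simp
    moreover have "(r + 1) * (u - 1) div (t * s - 1) = k"
      using eq pos by simp
    ultimately show ?thesis using k(1) by (simp add: of_nat_diff)
  qed
  show "real (size_V t s r) = (real r + 1) * (real s - 1) / (real t * real s - 1) - 1"
    unfolding size_V_def by (rule *) (use assms in auto)
  show "real (size_W t s r) = (real r + 1) * (real t - 1) / (real t * real s - 1) - 1"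
    unfolding size_W_def by (rule *) (use assms in auto)
qed

lemma gr_edges_subset:
  "gr_edges t s r \<subseteq> pverts (gr_graph t s r) \<times> pverts (gr_graph t s r)"
  unfolding gr_edges_def gr_graph_def side_V_def side_W_def by auto

lemma gr_edges_irrefl: "(x, x) \<notin> gr_edges t s r"
  unfolding gr_edges_def side_V_def side_W_def class_V_def class_W_def by auto

lemma finite_gr_vertices: "finite (pverts (gr_graph t s r))"
  unfolding gr_graph_def side_V_def side_W_def class_V_def class_W_def by simp

lemma pair_graph_gr_graph: "pair_graph (gr_graph t s r)"
proof -
  let ?G = "gr_graph t s r"
  have arcs: "parcs ?G = gr_edges t s r \<union> (gr_edges t s r)\<inverse>"
    by (simp add: gr_graph_def)
  have sub: "parcs ?G \<subseteq> pverts ?G \<times> pverts ?G"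
    unfolding arcs using gr_edges_subset[of t s r] by auto
  show ?thesis
  proof unfold_locales
    show "finite (parcs ?G)"
      using sub finite_gr_vertices by (meson finite_SigmaI finite_subset)
    show "symmetric (with_proj ?G)"
      unfolding symmetric_def with_proj_simps arcs by (rule sym_Un_converse)
    show "fst e \<noteq> snd e" if "e \<in> parcs ?G" for e
      using that gr_edges_irrefl[of "fst e" t s r] unfolding arcs by (cases e) auto
  qed (use sub finite_gr_vertices in \<open>auto\<close>)
qed

end

theory Submission
  imports Defs
begin

text \<open>
  Restriction to a star set \<open>X\<close> is injective on the eigenspace, as an eigenvector vanishing on \<open>X\<close>
  would be one of the star complement; by dimension it is bijective onto $\mathbb{R}^X$. So each
  \<open>u \<in> X\<close> has an eigenvector \<open>f\<close> for \<open>-1\<close> that restricts to the indicator of \<open>u\<close> on \<open>X\<close>. By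
  regularity \<open>f\<close> is orthogonal to the all-ones vector, and this together with the eigenvalue
  equations on $K_{t,s}$ forces \<open>f\<close> to be \<open>-1\<close> at a single vertex \<open>h\<close> of the star complement and \<open>0\<close>
  at the others. Then \<open>u\<close> and \<open>h\<close> have the same closed neighbourhood. Hence the graph arises from
  $K_{t,s}$ by replacing vertices by cliques; regularity makes the clique sizes constant on the two
  sides and determines them, and their integrality is the congruence.
\<close>

section \<open>Eigenspaces and star sets\<close>

text \<open>Reading off the coordinates in \<open>I\<close> is an injective linear map from the
  kernel to a space of the same dimension, hence surjective. In a basis of the kernel this map is a
  square matrix, whose inverse supplies the required vector.\<close>

lemma mat_kernel_interpolation:
  fixes A :: "'a :: field mat"
  assumes A: "A \<in> carrier_mat nr nc"
    and I: "I \<subseteq> {..<nc}" "card I = kernel_dim A"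
    and inj: "\<And>v. v \<in> mat_kernel A \<Longrightarrow> (\<And>i. i \<in> I \<Longrightarrow> v $ i = 0) \<Longrightarrow> v = 0\<^sub>v nc"
  shows "\<exists>v \<in> mat_kernel A. \<forall>i \<in> I. v $ i = g i"
proof -
  interpret kernel nr nc A by unfold_locales (rule A)
  obtain S where S: "finite S" "basis S" using kernel_basis_exists[OF A] by blast
  have SK: "S \<subseteq> mat_kernel A" and li: "lin_indpt S" using S(2) by (auto simp: Ker.basis_def)
  define k where "k = card I"
  have "card S = k" using Ker.dim_basis[OF S] I(2) by (simp add: k_def)
  then obtain b where b: "bij_betw b {..<k} S"
    using ex_bij_betw_nat_finite[OF S(1)] by (auto simp: atLeast0LessThan)
  have finI: "finite I" using I(1) finite_subset by blast
  obtain e where e: "bij_betw e {..<k} I"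
    using ex_bij_betw_nat_finite[OF finI] by (auto simp: atLeast0LessThan k_def)
  \<comment> \<open>Column \<open>j\<close> of \<open>M\<close> lists the
    \<open>I\<close>-coordinates of the \<open>j\<close>-th basis vector, so \<open>M\<close>
    applied to a coefficient vector \<open>c\<close> gives the \<open>I\<close>-coordinates of the
    combination \<open>L c\<close>.\<close>
  define M where "M = mat k k (\<lambda>(i, j). b j $ e i)"
  have M: "M \<in> carrier_mat k k" by (simp add: M_def)
  define L where "L c = lincomb (\<lambda>x. c $ (the_inv_into {..<k} b x)) S" for c :: "'a vec"
  have L_ker: "L c \<in> mat_kernel A" for c
    unfolding L_def using SK S(1) by (intro Ker.lincomb_closed) auto
  have L_index: "L c $ e i = (M *\<^sub>v c) $ i" if "i < k" "c \<in> carrier_vec k" for c i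
  proof -
    have "e i < nc" using e I(1) that(1) by (auto simp: bij_betw_def)
    then have "L c $ e i = (\<Sum>x\<in>S. c $ (the_inv_into {..<k} b x) * x $ e i)"
      unfolding L_def by (rule lincomb_index[OF _ SK])
    also have "\<dots> = (\<Sum>j<k. c $ (the_inv_into {..<k} b (b j)) * b j $ e i)"
      using sum.reindex_bij_betw[OF b, of "\<lambda>x. c $ (the_inv_into {..<k} b x) * x $ e i"] by simp
    also have "\<dots> = (\<Sum>j<k. b j $ e i * c $ j)"
      using b by (intro sum.cong) (auto simp: bij_betw_def the_inv_into_f_f)
    also have "\<dots> = (M *\<^sub>v c) $ i"
      using that by (simp add: M_def scalar_prod_def atLeast0LessThan)
    finally show ?thesis .
  qed
  \<comment> \<open>A nonzero \<open>c\<close> with \<open>M *\<^sub>v c\<close> zero would give a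
    kernel vector \<open>L c\<close> vanishing on \<open>I\<close>. By \<open>inj\<close> it is
    zero, a nontrivial relation among basis vectors.\<close>
  have "det M \<noteq> 0"
  proof
    assume "det M = 0"
    then obtain c where c: "c \<in> carrier_vec k" "c \<noteq> 0\<^sub>v k" "M *\<^sub>v c = 0\<^sub>v k"
      using det_0_iff_vec_prod_zero_field[OF M] by blast
    have "L c $ i = 0" if "i \<in> I" for i
    proof -
      obtain j where "j < k" "i = e j" using e \<open>i \<in> I\<close> by (auto simp: bij_betw_def)
      then show ?thesis using L_index[of j c] c by simp
    qed
    then have L0: "L c = 0\<^sub>v nc" using inj[OF L_ker] by blast
    have "c $ j = 0" if "j < k" for j
    proof (rule ccontr)
      assume "c $ j \<noteq> 0"
      moreover have "b j \<in> S" using b that by (auto simp: bij_betw_def)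
      moreover have "the_inv_into {..<k} b (b j) = j"
        using b that by (auto simp: bij_betw_def the_inv_into_f_f)
      ultimately have "lin_dep S"
        unfolding Ker.lin_dep_def using S(1) L0[unfolded L_def]
        by (intro exI[of _ S] exI[of _ "\<lambda>x. c $ (the_inv_into {..<k} b x)"] exI[of _ "b j"]) auto
      then show False using li by simp
    qed
    then have "c = 0\<^sub>v k" using c(1) by auto
    then show False using c(2) by simp
  qed
  \<comment> \<open>The prescribed values form the right-hand side \<open>w\<close>; the system is
    solved with \<open>N\<close>, the inverse of \<open>M\<close> built from its adjugate.\<close>
  define w where "w = vec k (\<lambda>i. g (e i))"
  define N where "N = (1 / det M) \<cdot>\<^sub>m adj_mat M"
  have w: "w \<in> carrier_vec k" by (simp add: w_def)
  have adj: "adj_mat M \<in> carrier_mat k k" "M * adj_mat M = det M \<cdot>\<^sub>m 1\<^sub>m k"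
    using adj_mat[OF M] by auto
  have N: "N \<in> carrier_mat k k" using adj(1) by (simp add: N_def)
  have "M * N = (1 / det M) \<cdot>\<^sub>m (M * adj_mat M)"
    unfolding N_def by (rule mult_smult_distrib[OF M adj(1)])
  also have "\<dots> = 1\<^sub>m k" using \<open>det M \<noteq> 0\<close> unfolding adj(2) by (intro eq_matI) auto
  finally have MN: "M * N = 1\<^sub>m k" .
  define c where "c = N *\<^sub>v w"
  have c: "c \<in> carrier_vec k" using N w by (simp add: c_def)
  have Mc: "M *\<^sub>v c = w"
    using assoc_mult_mat_vec[OF M N w] w by (simp add: c_def MN)
  have "L c $ i = g i" if "i \<in> I" for i
  proof -
    obtain j where "j < k" "i = e j" using e \<open>i \<in> I\<close> by (auto simp: bij_betw_def)
    then show ?thesis using L_index[of j c] c by (simp add: Mc w_def)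
  qed
  with L_ker show ?thesis by blast
qed

text \<open>Eigenvectors are treated as functions on the vertices, which frees the graph arguments
  from the arbitrary ordering behind \<open>adjacency_matrix\<close>. The zero function is allowed,
  so the predicate describes the whole eigenspace.\<close>

definition eigenfunction :: "('a, 'b) pre_digraph \<Rightarrow> real \<Rightarrow> ('a \<Rightarrow> real) \<Rightarrow> bool" where
  "eigenfunction G \<mu> f \<longleftrightarrow> (\<forall>x \<in> verts G. (\<Sum>y | y \<in> verts G \<and> x \<rightarrow>\<^bsub>G\<^esub> y. f y) = \<mu> * f x)"

context
  fixes G :: "('a, 'b) pre_digraph"
  assumes fin: "finite (verts G)"
begin

lemma vertex_enum: "distinct (vertex_enum G)" "set (vertex_enum G) = verts G"
  using someI_ex[OF finite_distinct_list[OF fin, THEN ex_cong1[THEN iffD1, rotated]],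
      of "\<lambda>xs. distinct xs \<and> set xs = verts G"]
  unfolding vertex_enum_def by blast+

lemma adjacency_matrix_carrier:
  "adjacency_matrix G \<in> carrier_mat (length (vertex_enum G)) (length (vertex_enum G))"
  by (simp add: adjacency_matrix_def Let_def)

lemma vec_in_mat_kernel_iff:
  "vec (length (vertex_enum G)) (\<lambda>i. f (vertex_enum G ! i))
     \<in> mat_kernel (char_matrix (adjacency_matrix G) \<mu>) \<longleftrightarrow> eigenfunction G \<mu> f"
proof -
  let ?xs = "vertex_enum G" let ?n = "length ?xs" let ?v = "vec ?n (\<lambda>i. f (?xs ! i))"
  let ?B = "char_matrix (adjacency_matrix G) \<mu>"
  have B: "?B \<in> carrier_mat ?n ?n" using adjacency_matrix_carrier by simp
  have bij: "bij_betw (\<lambda>i. ?xs ! i) {..<?n} (verts G)"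
    by (rule bij_betw_nth) (auto simp: vertex_enum)
  have "(?B *\<^sub>v ?v) $ i = (\<Sum>y | y \<in> verts G \<and> ?xs ! i \<rightarrow>\<^bsub>G\<^esub> y. f y) - \<mu> * f (?xs ! i)"
    if i: "i < ?n" for i
  proof -
    have "(?B *\<^sub>v ?v) $ i
      = (\<Sum>j<?n. ((if ?xs ! i \<rightarrow>\<^bsub>G\<^esub> ?xs ! j then 1 else 0) - (if i = j then \<mu> else 0)) * f (?xs ! j))"
      using i by (auto simp: char_matrix_def adjacency_matrix_def Let_def scalar_prod_def
          atLeast0LessThan intro!: sum.cong)
    also have "\<dots> = (\<Sum>j<?n. if ?xs ! i \<rightarrow>\<^bsub>G\<^esub> ?xs ! j then f (?xs ! j) else 0) - \<mu> * f (?xs ! i)"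
      using i by (simp add: left_diff_distrib sum_subtractf if_distrib[of "\<lambda>x. x * _"] cong: if_cong)
    also have "(\<Sum>j<?n. if ?xs ! i \<rightarrow>\<^bsub>G\<^esub> ?xs ! j then f (?xs ! j) else 0)
      = (\<Sum>y\<in>verts G. if ?xs ! i \<rightarrow>\<^bsub>G\<^esub> y then f y else 0)"
      by (rule sum.reindex_bij_betw[OF bij])
    also have "\<dots> = (\<Sum>y | y \<in> verts G \<and> ?xs ! i \<rightarrow>\<^bsub>G\<^esub> y. f y)"
      using fin by (intro sum.inter_filter[symmetric])
    finally show ?thesis .
  qed
  then have "?B *\<^sub>v ?v = 0\<^sub>v ?n \<longleftrightarrow>
      (\<forall>i<?n. (\<Sum>y | y \<in> verts G \<and> ?xs ! i \<rightarrow>\<^bsub>G\<^esub> y. f y) = \<mu> * f (?xs ! i))"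
    using B by (subst vec_eq_iff) auto
  then show ?thesis
    unfolding mat_kernel[OF B] eigenfunction_def vertex_enum(2)[symmetric] all_set_conv_all_nth
    by simp
qed

lemma vec_as_function:
  assumes "v \<in> carrier_vec (length (vertex_enum G))"
  obtains f where "v = vec (length (vertex_enum G)) (\<lambda>i. f (vertex_enum G ! i))"
proof
  let ?xs = "vertex_enum G"
  \<comment> \<open>The inverse of the enumeration sends a vertex to its index, which is well
    defined because the list is distinct.\<close>
  show "v = vec (length ?xs) (\<lambda>i. (\<lambda>x. v $ the_inv_into {..<length ?xs} ((!) ?xs) x) (?xs ! i))"
    using assms vertex_enum(1)
    by (intro eq_vecI) (auto simp: the_inv_into_f_f inj_on_nth)
qed

lemma graph_eigenvalue_iff_eigenfunction:
  "graph_eigenvalue G \<mu> \<longleftrightarrow> (\<exists>f. eigenfunction G \<mu> f \<and> (\<exists>x \<in> verts G. f x \<noteq> 0))"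
proof -
  let ?xs = "vertex_enum G" let ?n = "length ?xs" let ?v = "\<lambda>f. vec ?n (\<lambda>i. f (?xs ! i))"
  let ?B = "char_matrix (adjacency_matrix G) \<mu>"
  have B: "?B \<in> carrier_mat ?n ?n" using adjacency_matrix_carrier by simp
  have "graph_eigenvalue G \<mu> \<longleftrightarrow> (\<exists>v \<in> mat_kernel ?B. v \<noteq> 0\<^sub>v ?n)"
    unfolding graph_eigenvalue_def eigenvalue_char_matrix[OF adjacency_matrix_carrier] mat_kernel[OF B]
    by blast
  also have "\<dots> \<longleftrightarrow> (\<exists>f. eigenfunction G \<mu> f \<and> ?v f \<noteq> 0\<^sub>v ?n)"
    using vec_in_mat_kernel_iff[of _ \<mu>] mat_kernel_carrier[OF B] vec_as_function
    by (metis subsetD)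
  also have "\<dots> \<longleftrightarrow> (\<exists>f. eigenfunction G \<mu> f \<and> (\<exists>x \<in> verts G. f x \<noteq> 0))"
    unfolding vertex_enum(2)[symmetric] by (auto simp: vec_eq_iff set_conv_nth)
  finally show ?thesis .
qed

end

lemma (in wf_digraph) arcs_ends_induce_subgraph:
  "arcs_ends (G \<restriction> S) = arcs_ends G \<inter> S \<times> S"
  by (auto simp: arcs_ends_conv)

lemma star_set_eigenfunction:
  assumes "fin_digraph G" and star: "star_set G \<mu> X"
  obtains f where "eigenfunction G \<mu> f" "\<And>x. x \<in> X \<Longrightarrow> f x = g x"
proof -
  interpret fin_digraph G by fact
  let ?xs = "vertex_enum G" let ?n = "length ?xs" let ?v = "\<lambda>f. vec ?n (\<lambda>i. f (?xs ! i))"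
  let ?B = "char_matrix (adjacency_matrix G) \<mu>"
  note enum = vertex_enum[OF finite_verts]
  have B: "?B \<in> carrier_mat ?n ?n" using adjacency_matrix_carrier[OF finite_verts] by simp
  have X: "X \<subseteq> verts G" "card X = kernel_dim ?B" "\<not> graph_eigenvalue (G \<restriction> (verts G - X)) \<mu>"
    using star by (auto simp: star_set_def eigenvalue_multiplicity_def)
  \<comment> \<open>\<open>I\<close> is the star set transported to matrix indices; its size is the
    kernel dimension by the definition of a star set.\<close>
  define I where "I = {i. i < ?n \<and> ?xs ! i \<in> X}"
  have inj_xs: "inj_on ((!) ?xs) {..<?n}" using enum(1) by (simp add: inj_on_nth)
  have im: "(!) ?xs ` I = X" using X(1) unfolding enum(2)[symmetric] 
    by (fastforce simp: I_def set_conv_nth)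
  have "\<exists>v \<in> mat_kernel ?B. \<forall>i \<in> I. v $ i = g (?xs ! i)"
  proof (rule mat_kernel_interpolation[OF B])
    show "I \<subseteq> {..<?n}" by (auto simp: I_def)
    then show "card I = kernel_dim ?B"
      using card_image[OF inj_on_subset[OF inj_xs], of I] im X(2) by simp
    fix v assume v: "v \<in> mat_kernel ?B" and v0: "\<And>i. i \<in> I \<Longrightarrow> v $ i = 0"
    obtain f where f: "v = ?v f"
      using vec_as_function[OF finite_verts] v mat_kernel_carrier[OF B] by blast
    have f0: "f x = 0" if "x \<in> X" for x
    proof -
      obtain i where "i \<in> I" "x = ?xs ! i" using \<open>x \<in> X\<close> unfolding im[symmetric] by (rule imageE)
      then show ?thesis using v0[of i] by (simp add: f I_def)
    qed
    have ef: "eigenfunction G \<mu> f" using v vec_in_mat_kernel_iff[OF finite_verts] by (simp add: f)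
    have "eigenfunction (G \<restriction> (verts G - X)) \<mu> f"
      unfolding eigenfunction_def
    proof
      fix x assume "x \<in> verts (G \<restriction> (verts G - X))"
      then have x: "x \<in> verts G" "x \<notin> X" by auto
      \<comment> \<open>As \<open>f\<close> vanishes on \<open>X\<close>, deleting \<open>X\<close>
        changes no neighbour sum, so the eigenvalue equations pass to the star complement.\<close>
      have "(\<Sum>y | y \<in> verts (G \<restriction> (verts G - X)) \<and> x \<rightarrow>\<^bsub>G \<restriction> (verts G - X)\<^esub> y. f y)
          = (\<Sum>y | y \<in> verts G \<and> x \<rightarrow>\<^bsub>G\<^esub> y. f y)"
        using x f0 by (intro sum.mono_neutral_left) (auto simp: arcs_ends_induce_subgraph)
      then show "(\<Sum>y | y \<in> verts (G \<restriction> (verts G - X)) \<and> x \<rightarrow>\<^bsub>G \<restriction> (verts G - X)\<^esub> y. f y) = \<mu> * f x"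
        using ef x by (simp add: eigenfunction_def)
    qed
    then have "f x = 0" if "x \<in> verts G - X" for x
      using X(3) that by (auto simp: graph_eigenvalue_iff_eigenfunction)
    with f0 have "f x = 0" if "x \<in> verts G" for x using that by blast
    then show "v = 0\<^sub>v ?n" unfolding f enum(2)[symmetric] by (auto simp: vec_eq_iff)
  qed
  then obtain v where v: "v \<in> mat_kernel ?B" "\<And>i. i \<in> I \<Longrightarrow> v $ i = g (?xs ! i)" by blast
  obtain f where f: "v = ?v f"
    using vec_as_function[OF finite_verts] v(1) mat_kernel_carrier[OF B] by blast
  show ?thesis
  proof
    show "eigenfunction G \<mu> f" using v(1) vec_in_mat_kernel_iff[OF finite_verts] by (simp add: f)
    fix x assume "x \<in> X"
    then obtain i where "i \<in> I" "x = ?xs ! i" unfolding im[symmetric] by (rule imageE)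
    then show "f x = g x" using v(2)[of i] by (simp add: f I_def)
  qed
qed

section \<open>Closed twins\<close>

text \<open>Without parallel arcs, an arc leaving \<open>x\<close> is determined by its
  head.\<close>

lemma (in nomulti_digraph) out_degree_eq_card_neighbours:
  "out_degree G x = card {y. x \<rightarrow>\<^bsub>G\<^esub> y}"
proof -
  have "inj_on (arc_to_ends G) (out_arcs G x)"
    using inj_on_arc_to_ends by (rule inj_on_subset) auto
  moreover have "arc_to_ends G ` out_arcs G x = Pair x ` {y. x \<rightarrow>\<^bsub>G\<^esub> y}"
    by (auto simp: arcs_ends_def arc_to_ends_def)
  moreover have "inj_on (Pair x) {y. x \<rightarrow>\<^bsub>G\<^esub> y}" by (simp add: inj_on_def)
  ultimately show ?thesis unfolding out_degree_def using card_image by metis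
qed

lemma (in graph) adj_commute: "x \<rightarrow>\<^bsub>G\<^esub> y \<longleftrightarrow> y \<rightarrow>\<^bsub>G\<^esub> x"
  using arcs_ends_symmetric[OF sym_arcs] by blast

lemma (in graph) regular_card_neighbours:
  assumes "regular_graph r G" "x \<in> verts G"
  shows "card {y. x \<rightarrow>\<^bsub>G\<^esub> y} = r"
  using assms out_degree_eq_card_neighbours by (simp add: regular_graph_def)

text \<open>In a regular graph the all-ones vector is an eigenvector for \<open>r\<close>, and
  eigenvectors of a symmetric matrix for different eigenvalues are orthogonal. The proof sums the
  eigenvalue equations over all vertices and swaps the order of summation.\<close>

lemma (in graph) eigenfunction_sum_zero:
  assumes reg: "regular_graph r G" and f: "eigenfunction G \<theta> f" and "\<theta> \<noteq> real r"
  shows "(\<Sum>x\<in>verts G. f x) = 0"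
proof -
  have "\<theta> * (\<Sum>x\<in>verts G. f x) = (\<Sum>x\<in>verts G. \<Sum>y | y \<in> verts G \<and> x \<rightarrow>\<^bsub>G\<^esub> y. f y)"
    using f by (simp add: eigenfunction_def sum_distrib_left)
  also have "\<dots> = (\<Sum>y\<in>verts G. \<Sum>x | x \<in> verts G \<and> x \<rightarrow>\<^bsub>G\<^esub> y. f y)"
    by (rule sum.swap_restrict) auto
  also have "\<dots> = (\<Sum>y\<in>verts G. real r * f y)"
  proof (rule sum.cong)
    fix y assume "y \<in> verts G"
    moreover have "{x. x \<in> verts G \<and> x \<rightarrow>\<^bsub>G\<^esub> y} = {x. y \<rightarrow>\<^bsub>G\<^esub> x}"
      using adj_commute adj_in_verts by blast
    ultimately show "(\<Sum>x | x \<in> verts G \<and> x \<rightarrow>\<^bsub>G\<^esub> y. f y) = real r * f y"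
      using regular_card_neighbours[OF reg] by simp
  qed simp
  finally have "(\<theta> - real r) * (\<Sum>x\<in>verts G. f x) = 0"
    by (simp add: sum_distrib_left[symmetric] left_diff_distrib)
  then show ?thesis using assms(3) by simp
qed

text \<open>This relation is the 0-1 matrix A + I, with A the adjacency matrix. For the eigenvalue
  -1 the equation reads (A + I) f = 0, so closed neighbourhoods are the natural notion.\<close>

definition closed_adj :: "('a, 'b) pre_digraph \<Rightarrow> 'a \<Rightarrow> 'a \<Rightarrow> bool" where
  "closed_adj G x y \<longleftrightarrow> x = y \<or> x \<rightarrow>\<^bsub>G\<^esub> y"

lemma (in graph) closed_adj_commute: "closed_adj G x y \<longleftrightarrow> closed_adj G y x"
  using adj_commute by (auto simp: closed_adj_def)

lemma (in graph) eigenfunction_minus_one: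
  assumes "eigenfunction G (-1) f" "x \<in> verts G"
  shows "(\<Sum>y | y \<in> verts G \<and> closed_adj G x y. f y) = 0"
proof -
  have "{y \<in> verts G. closed_adj G x y} = insert x {y \<in> verts G. x \<rightarrow>\<^bsub>G\<^esub> y}"
    using assms(2) by (auto simp: closed_adj_def)
  moreover have "\<not> x \<rightarrow>\<^bsub>G\<^esub> x" using adj_not_same by blast
  ultimately show ?thesis using assms by (simp add: eigenfunction_def)
qed

text \<open>The sum of \<open>f\<close> over the closed neighbourhood of \<open>x\<close> is zero,
  and only \<open>u\<close> and \<open>h\<close> can contribute to it, with 1 and -1. Hence both
  occur or neither does.\<close>

lemma (in graph) closed_twins:
  assumes f: "eigenfunction G (-1) f" and uh: "u \<in> verts G" "h \<in> verts G" "u \<noteq> h"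
    and val: "f u = 1" "f h = -1" "\<And>y. y \<in> verts G - {u, h} \<Longrightarrow> f y = 0"
    and x: "x \<in> verts G"
  shows "closed_adj G x u \<longleftrightarrow> closed_adj G x h"
proof -
  have "0 = (\<Sum>y | y \<in> verts G \<and> closed_adj G x y. f y)"
    using eigenfunction_minus_one[OF f x] by simp
  also have "\<dots> = (\<Sum>y \<in> {u, h}. if closed_adj G x y then f y else 0)"
    using uh val(3) unfolding sum.inter_filter[OF finite_verts]
    by (intro sum.mono_neutral_right) auto
  finally show ?thesis using uh(3) val(1,2) by (auto split: if_splits)
qed

text \<open>With \<open>\<sigma>\<close> the sum of \<open>- f\<close> over \<open>P\<close>, the sum over \<open>Q\<close> is \<open>1 - \<sigma>\<close> by orthogonality to the
  all-ones vector. The eigenvalue equations at \<open>P\<close> and \<open>Q\<close> give the numbers \<open>a\<close>, \<open>b\<close> of neighbours of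
  \<open>u\<close> in \<open>P\<close>, \<open>Q\<close>, and the one at \<open>u\<close> then reads \<open>\<sigma> * (1 - \<sigma>) * (t + s - 2) = 0\<close>.\<close>
lemma star_complement_twin:
  fixes f :: "'a \<Rightarrow> real"
  assumes fin: "finite P" "finite Q"
    and card: "card P = t" "card Q = s" "t + s > 2"
    and P: "\<And>p. p \<in> P \<Longrightarrow> f p + (\<Sum>q\<in>Q. f q) + (if N p then 1 else 0) = 0"
    and Q: "\<And>q. q \<in> Q \<Longrightarrow> f q + (\<Sum>p\<in>P. f p) + (if N q then 1 else 0) = 0"
    and u: "(\<Sum>p | p \<in> P \<and> N p. f p) + (\<Sum>q | q \<in> Q \<and> N q. f q) + 1 = 0"
    and total: "(\<Sum>p\<in>P. f p) + (\<Sum>q\<in>Q. f q) + 1 = 0"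
  shows "(\<exists>h\<in>P. f h = -1 \<and> (\<forall>y\<in>P \<union> Q - {h}. f y = 0))
       \<or> (\<exists>h\<in>Q. f h = -1 \<and> (\<forall>y\<in>P \<union> Q - {h}. f y = 0))"
proof -
  define \<sigma> where "\<sigma> = - (\<Sum>p\<in>P. f p)"
  have sP: "(\<Sum>p\<in>P. f p) = - \<sigma>" and sQ: "(\<Sum>q\<in>Q. f q) = \<sigma> - 1"
    using total by (simp_all add: \<sigma>_def)
  define a b where "a = real (card {p\<in>P. N p})" and "b = real (card {q\<in>Q. N q})"
  have fP: "f p = 1 - \<sigma> - (if N p then 1 else 0)" if "p \<in> P" for p using P[OF that] sQ by simp
  have fQ: "f q = \<sigma> - (if N q then 1 else 0)" if "q \<in> Q" for q using Q[OF that] sP by simp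
  have "- \<sigma> = (\<Sum>p\<in>P. 1 - \<sigma> - (if N p then 1 else 0))" using fP sP by (metis (no_types, lifting) sum.cong)
  also have "\<dots> = real t * (1 - \<sigma>) - a"
    by (simp add: sum_subtractf sum.inter_filter[OF fin(1), symmetric] a_def card algebra_simps)
  finally have a: "a = \<sigma> + real t * (1 - \<sigma>)" by simp
  have "\<sigma> - 1 = (\<Sum>q\<in>Q. \<sigma> - (if N q then 1 else 0))" using fQ sQ by (metis (no_types, lifting) sum.cong)
  also have "\<dots> = real s * \<sigma> - b"
    by (simp add: sum_subtractf sum.inter_filter[OF fin(2), symmetric] b_def card algebra_simps)
  finally have b: "b = 1 - \<sigma> + real s * \<sigma>" by simp
  have "(\<Sum>p | p \<in> P \<and> N p. f p) = a * - \<sigma>" using fP by (simp add: a_def)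
  moreover have "(\<Sum>q | q \<in> Q \<and> N q. f q) = b * (\<sigma> - 1)" using fQ by (simp add: b_def)
  ultimately have "a * \<sigma> + b * (1 - \<sigma>) = 1" using u by (simp add: algebra_simps)
  \<comment> \<open>After substituting \<open>a\<close> and \<open>b\<close>, use \<sigma>^2 + (1 -
    \<sigma>)^2 = 1 - 2 \<sigma> (1 - \<sigma>).\<close>
  then have "(real t + real s - 2) * (\<sigma> * (1 - \<sigma>)) = 0"
    unfolding a b by (simp add: algebra_simps power2_eq_square)
  moreover have "real t + real s - 2 \<noteq> 0" using card(3) by linarith
  ultimately consider "\<sigma> = 1" | "\<sigma> = 0" by auto
  then show ?thesis
  proof cases
    case 1
    \<comment> \<open>Here a = 1 and b = s: \<open>u\<close> sees one vertex \<open>h\<close> of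
      \<open>P\<close> and all of \<open>Q\<close>, just as a closed twin of \<open>h\<close> does.
      The other case is the mirror image.\<close>
    then have "card {p\<in>P. N p} = 1" using a by (simp add: a_def)
    then obtain h where h: "{p\<in>P. N p} = {h}" by (auto simp: card_1_singleton_iff)
    have "card {q\<in>Q. N q} = card Q" using b 1 by (simp add: b_def card)
    then have "{q\<in>Q. N q} = Q" using fin(2) by (intro card_subset_eq) auto
    then have "N q" if "q \<in> Q" for q using that by blast
    then have "f q = 0" if "q \<in> Q" for q using fQ[OF that] that 1 by simp
    moreover have "f p = 0" if "p \<in> P - {h}" for p
    proof -
      have "\<not> N p" using h that by blast
      then show ?thesis using fP[of p] that 1 by simp
    qed
    ultimately have "\<forall>y\<in>P \<union> Q - {h}. f y = 0" by blast
    moreover have "h \<in> P" "N h" using h by blast+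
    then have "h \<in> P" "f h = -1" using fP 1 by simp_all
    ultimately show ?thesis by blast
  next
    case 2
    then have "card {q\<in>Q. N q} = 1" using b by (simp add: b_def)
    then obtain h where h: "{q\<in>Q. N q} = {h}" by (auto simp: card_1_singleton_iff)
    have "card {p\<in>P. N p} = card P" using a 2 by (simp add: a_def card)
    then have "{p\<in>P. N p} = P" using fin(1) by (intro card_subset_eq) auto
    then have "N p" if "p \<in> P" for p using that by blast
    then have "f p = 0" if "p \<in> P" for p using fP[OF that] that 2 by simp
    moreover have "f q = 0" if "q \<in> Q - {h}" for q
    proof -
      have "\<not> N q" using h that by blast
      then show ?thesis using fQ[of q] that 2 by simp
    qed
    ultimately have "\<forall>y\<in>P \<union> Q - {h}. f y = 0" by blast
    moreover have "h \<in> Q" "N h" using h by blast+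
    then have "h \<in> Q" "f h = -1" using fQ 2 by simp_all
    ultimately show ?thesis by blast
  qed
qed

section \<open>Twin classes over the bipartite star complement\<close>

locale bipartite_star_complement = graph G for G :: "('a, 'b) pre_digraph" +
  fixes r t s :: nat and X P Q :: "'a set"
  assumes ts: "2 \<le> t" "2 \<le> s"
    and regular: "regular_graph r G"
    and star: "star_set G (-1) X"
    and parts: "verts G - X = P \<union> Q" "P \<inter> Q = {}"
    and card_parts: "card P = t" "card Q = s"
    and adj_parts: "arcs_ends G \<inter> (P \<union> Q) \<times> (P \<union> Q) = P \<times> Q \<union> Q \<times> P"
begin

lemma X_verts: "X \<subseteq> verts G" using star by (simp add: star_set_def)

lemma verts_eq: "verts G = X \<union> P \<union> Q" and disj: "X \<inter> (P \<union> Q) = {}"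
  using parts X_verts by auto

lemma finite_parts: "finite X" "finite P" "finite Q"
  using finite_verts by (simp_all add: verts_eq)

lemma closed_adj_parts:
  "p \<in> P \<Longrightarrow> p' \<in> P \<Longrightarrow> closed_adj G p p' \<longleftrightarrow> p = p'"
  "q \<in> Q \<Longrightarrow> q' \<in> Q \<Longrightarrow> closed_adj G q q' \<longleftrightarrow> q = q'"
  "p \<in> P \<Longrightarrow> q \<in> Q \<Longrightarrow> closed_adj G p q"
  "p \<in> P \<Longrightarrow> q \<in> Q \<Longrightarrow> closed_adj G q p"
proof -
  have *: "(x, y) \<in> arcs_ends G \<longleftrightarrow> (x, y) \<in> P \<times> Q \<union> Q \<times> P" if "x \<in> P \<union> Q" "y \<in> P \<union> Q" for x y
    using adj_parts that by blast
  show "p \<in> P \<Longrightarrow> p' \<in> P \<Longrightarrow> closed_adj G p p' \<longleftrightarrow> p = p'"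
    "q \<in> Q \<Longrightarrow> q' \<in> Q \<Longrightarrow> closed_adj G q q' \<longleftrightarrow> q = q'"
    "p \<in> P \<Longrightarrow> q \<in> Q \<Longrightarrow> closed_adj G p q"
    "p \<in> P \<Longrightarrow> q \<in> Q \<Longrightarrow> closed_adj G q p"
    using * parts(2) by (auto simp: closed_adj_def)
qed

lemma exists_twin:
  assumes u: "u \<in> X"
  shows "\<exists>h \<in> P \<union> Q. \<forall>x \<in> verts G. closed_adj G x u \<longleftrightarrow> closed_adj G x h"
proof -
  obtain f where f: "eigenfunction G (-1) f" and fX: "\<And>x. x \<in> X \<Longrightarrow> f x = (if x = u then 1 else 0)"
    by (rule star_set_eigenfunction[OF fin_digraph star, of "\<lambda>x. if x = u then 1 else 0"]) (rule that)
  \<comment> \<open>On \<open>X\<close> the function is the indicator of \<open>u\<close>, so the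
    \<open>X\<close>-part of any sum collapses to a single term. Taking \<open>R\<close> as a closed
    neighbourhood gives the local equations; taking it constantly true gives the total.\<close>
  have split: "(\<Sum>y | y \<in> verts G \<and> R y. f y)
      = (\<Sum>y | y \<in> P \<and> R y. f y) + (\<Sum>y | y \<in> Q \<and> R y. f y) + (if R u then 1 else 0)" for R
  proof -
    have "{y. y \<in> verts G \<and> R y} = ({y. y \<in> P \<and> R y} \<union> {y. y \<in> Q \<and> R y}) \<union> {y. y \<in> X \<and> R y}"
      by (auto simp: verts_eq)
    then have "(\<Sum>y | y \<in> verts G \<and> R y. f y)
      = (\<Sum>y \<in> {y. y \<in> P \<and> R y} \<union> {y. y \<in> Q \<and> R y}. f y) + (\<Sum>y | y \<in> X \<and> R y. f y)"
      using finite_parts disj by (simp only:, intro sum.union_disjoint) auto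
    also have "(\<Sum>y \<in> {y. y \<in> P \<and> R y} \<union> {y. y \<in> Q \<and> R y}. f y)
      = (\<Sum>y | y \<in> P \<and> R y. f y) + (\<Sum>y | y \<in> Q \<and> R y. f y)"
      using finite_parts parts(2) by (intro sum.union_disjoint) auto
    also have "(\<Sum>y | y \<in> X \<and> R y. f y) = (\<Sum>y | y \<in> X \<and> R y. if y = u then 1 else 0)"
      by (intro sum.cong) (auto simp: fX)
    also have "\<dots> = (if R u then 1 else 0)" using finite_parts(1) u by simp
    finally show ?thesis .
  qed
  have eq: "(\<Sum>y | y \<in> P \<and> closed_adj G x y. f y) + (\<Sum>y | y \<in> Q \<and> closed_adj G x y. f y)
      + (if closed_adj G x u then 1 else 0) = 0" if "x \<in> verts G" for x
    using eigenfunction_minus_one[OF f that] split by metis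
  have "(\<exists>h\<in>P. f h = -1 \<and> (\<forall>y\<in>P \<union> Q - {h}. f y = 0))
       \<or> (\<exists>h\<in>Q. f h = -1 \<and> (\<forall>y\<in>P \<union> Q - {h}. f y = 0))"
  proof (rule star_complement_twin[where N = "\<lambda>x. closed_adj G x u"])
    show "t + s > 2" using ts by simp
  next
    fix p assume p: "p \<in> P"
    have "{y. y \<in> P \<and> closed_adj G p y} = {p}" "{y. y \<in> Q \<and> closed_adj G p y} = Q"
      using closed_adj_parts p by auto
    then show "f p + (\<Sum>q\<in>Q. f q) + (if closed_adj G p u then 1 else 0) = 0"
      using eq[of p] p by (simp add: verts_eq)
  next
    fix q assume q: "q \<in> Q"
    have "{y. y \<in> Q \<and> closed_adj G q y} = {q}" "{y. y \<in> P \<and> closed_adj G q y} = P"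
      using closed_adj_parts q by auto
    then show "f q + (\<Sum>p\<in>P. f p) + (if closed_adj G q u then 1 else 0) = 0"
      using eq[of q] q by (simp add: verts_eq)
  next
    show "(\<Sum>p | p \<in> P \<and> closed_adj G p u. f p) + (\<Sum>q | q \<in> Q \<and> closed_adj G q u. f q) + 1 = 0"
      using eq[of u] u X_verts by (auto simp: closed_adj_commute[of _ u] closed_adj_def[of _ u u])
  next
    show "(\<Sum>p\<in>P. f p) + (\<Sum>q\<in>Q. f q) + 1 = 0"
      \<comment> \<open>Orthogonality applies because -1 differs from the nonnegative degree
        \<open>r\<close>.\<close>
      using split[of "\<lambda>_. True"] eigenfunction_sum_zero[OF regular f] by simp
  qed (use finite_parts card_parts in auto)
  then obtain h where h: "h \<in> P \<union> Q" "f h = -1" "\<And>y. y \<in> P \<union> Q - {h} \<Longrightarrow> f y = 0" by blast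
  have "closed_adj G x u \<longleftrightarrow> closed_adj G x h" if "x \<in> verts G" for x
  proof (rule closed_twins[OF f _ _ _ _ h(2) _ that])
    show "u \<noteq> h" using u h(1) disj by auto
    show "f y = 0" if "y \<in> verts G - {u, h}" for y
      using that h(3)[of y] fX[of y] by (auto simp: verts_eq)
  qed (use u h(1) fX in \<open>auto simp: verts_eq\<close>)
  with h(1) show ?thesis by blast
qed

text \<open>Being the identity off \<open>X\<close>, this is a retraction of the vertex set onto the
  star complement. Its fibres will correspond to the sets formed by v_i with V_i, or w_j with
  W_j.\<close>

definition twin :: "'a \<Rightarrow> 'a" where
  "twin u = (if u \<in> X
     then SOME h. h \<in> P \<union> Q \<and> (\<forall>x \<in> verts G. closed_adj G x u \<longleftrightarrow> closed_adj G x h) else u)"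

lemma twin: 
  assumes "u \<in> verts G"
  shows "twin u \<in> P \<union> Q" "\<And>x. x \<in> verts G \<Longrightarrow> closed_adj G x u \<longleftrightarrow> closed_adj G x (twin u)"
proof -
  have "twin u \<in> P \<union> Q \<and> (\<forall>x \<in> verts G. closed_adj G x u \<longleftrightarrow> closed_adj G x (twin u))"
  proof (cases "u \<in> X")
    case True
    have "\<exists>h. h \<in> P \<union> Q \<and> (\<forall>x \<in> verts G. closed_adj G x u \<longleftrightarrow> closed_adj G x h)"
      using exists_twin[OF True] by blast
    from someI_ex[OF this] show ?thesis unfolding twin_def if_P[OF True] .
  next
    case False
    then show ?thesis using assms by (auto simp: twin_def verts_eq)
  qed
  then show "twin u \<in> P \<union> Q" "\<And>x. x \<in> verts G \<Longrightarrow> closed_adj G x u \<longleftrightarrow> closed_adj G x (twin u)"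
    by auto
qed

text \<open>By symmetry of \<open>closed_adj\<close>, both arguments can be replaced by their twins,
  one after the other, and the question is then decided in the complete bipartite graph. The
  equivalence on the right says that the twins lie on opposite sides. So the graph is a blow-up of
  the star complement by cliques.\<close>

lemma closed_adj_twin:
  assumes "x \<in> verts G" "y \<in> verts G"
  shows "closed_adj G x y \<longleftrightarrow> twin x = twin y \<or> (twin x \<in> P \<longleftrightarrow> twin y \<in> Q)"
proof -
  have "twin x \<in> verts G" "twin y \<in> verts G" using twin(1) assms by (auto simp: verts_eq)
  then have "closed_adj G x y \<longleftrightarrow> closed_adj G (twin x) (twin y)"
    using twin(2) assms closed_adj_commute by blast
  then show ?thesis
    using twin(1)[OF assms(1)] twin(1)[OF assms(2)] closed_adj_parts parts(2) by auto
qed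

lemma twin_parts: "h \<in> P \<union> Q \<Longrightarrow> twin h = h"
  using disj by (auto simp: twin_def)

definition fibre :: "'a \<Rightarrow> nat" where
  "fibre h = card {x \<in> verts G. twin x = h}"

text \<open>The closed neighbourhood of \<open>h\<close> has r + 1 elements and is the disjoint
  union of the fibre of \<open>h\<close> and the fibres over the opposite side.\<close>

lemma fibre_degree:
  assumes "h \<in> P \<union> Q"
  shows "r + 1 = fibre h + (\<Sum>h' \<in> (if h \<in> P then Q else P). fibre h')"
proof -
  let ?R = "if h \<in> P then Q else P"
  have h: "h \<in> verts G" using assms by (auto simp: verts_eq)
  have "{y. h \<rightarrow>\<^bsub>G\<^esub> y} \<subseteq> verts G" using adj_in_verts by blast
  then have "finite {y. h \<rightarrow>\<^bsub>G\<^esub> y}" using finite_verts by (rule finite_subset)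
  then have "r + 1 = card (insert h {y. h \<rightarrow>\<^bsub>G\<^esub> y})"
    using regular_card_neighbours[OF regular h] adj_not_same by (subst card_insert_disjoint) auto
  also have "insert h {y. h \<rightarrow>\<^bsub>G\<^esub> y} = {y \<in> verts G. closed_adj G h y}"
    using h adj_in_verts by (auto simp: closed_adj_def)
  also have "\<dots> = (\<Union>h' \<in> insert h ?R. {x \<in> verts G. twin x = h'})"
  proof (rule Set.set_eqI)
    show "x \<in> {y \<in> verts G. closed_adj G h y} \<longleftrightarrow> x \<in> (\<Union>h' \<in> insert h ?R. {x \<in> verts G. twin x = h'})"
      for x
      using closed_adj_twin[OF h, of x] twin(1)[of x] twin_parts[OF assms] assms parts(2) by auto
  qed
  also have "card \<dots> = (\<Sum>h' \<in> insert h ?R. fibre h')"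
    unfolding fibre_def using finite_parts by (intro card_UN_disjoint) auto
  also have "\<dots> = fibre h + (\<Sum>h' \<in> ?R. fibre h')"
    using finite_parts assms parts(2) by (intro sum.insert) auto
  finally show ?thesis .
qed

lemma fibre_const:
  obtains c d where "\<And>p. p \<in> P \<Longrightarrow> fibre p = c" "\<And>q. q \<in> Q \<Longrightarrow> fibre q = d"
    "r + 1 = c + s * d" "r + 1 = d + t * c" "c > 0" "d > 0"
proof
  \<comment> \<open>For \<open>p\<close> in \<open>P\<close> the sum over the opposite side does not
    depend on \<open>p\<close>, so neither does \<open>fibre p\<close>. The subtractions do not
    truncate, by \<open>eqP\<close> and \<open>eqQ\<close>.\<close>
  define c d where "c = r + 1 - (\<Sum>q\<in>Q. fibre q)" and "d = r + 1 - (\<Sum>p\<in>P. fibre p)"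
  have eqP: "r + 1 = fibre p + (\<Sum>q\<in>Q. fibre q)" if "p \<in> P" for p
    using fibre_degree[of p] that by simp
  have eqQ: "r + 1 = fibre q + (\<Sum>p\<in>P. fibre p)" if "q \<in> Q" for q
    using fibre_degree[of q] that parts(2) by (auto split: if_splits)
  show c: "fibre p = c" if "p \<in> P" for p using eqP[OF that] by (simp add: c_def)
  show d: "fibre q = d" if "q \<in> Q" for q using eqQ[OF that] by (simp add: d_def)
  have "P \<noteq> {}" "Q \<noteq> {}" using ts card_parts by auto
  then obtain p q where pq: "p \<in> P" "q \<in> Q" by blast
  show "r + 1 = c + s * d" using eqP[OF pq(1)] c d pq card_parts by simp
  show "r + 1 = d + t * c" using eqQ[OF pq(2)] c d pq card_parts by simp
  \<comment> \<open>Each \<open>h\<close> lies in its own fibre. Positivity later ensures that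
    subtracting 1 from a class size does not truncate.\<close>
  have "fibre h > 0" if "h \<in> P \<union> Q" for h
  proof -
    have "h \<in> {x \<in> verts G. twin x = h}" using that twin_parts by (auto simp: verts_eq)
    then show ?thesis unfolding fibre_def by (subst card_gt_0_iff) auto
  qed
  then show "c > 0" "d > 0" using c d pq by (metis UnI1, metis UnI2)
qed

end

section \<open>Identification with \<open>G(r)\<close>\<close>

text \<open>Arcs on both sides are determined by their ends, so a vertex bijection preserving
  adjacency in both directions induces the arc bijection that the library's notion of isomorphism
  asks for.\<close>

lemma digraph_iso_with_projI:
  fixes G :: "('a, 'b) pre_digraph" and H :: "'c pair_pre_digraph"
  assumes G: "nomulti_digraph G" and H: "pair_wf_digraph H"
    and \<phi>: "bij_betw \<phi> (verts G) (pverts H)"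
    and adj: "\<And>x y. x \<in> verts G \<Longrightarrow> y \<in> verts G \<Longrightarrow> x \<rightarrow>\<^bsub>G\<^esub> y \<longleftrightarrow> (\<phi> x, \<phi> y) \<in> parcs H"
  shows "digraph_iso G (with_proj H)"
proof -
  interpret nomulti_digraph G by fact
  interpret H: pair_wf_digraph H by fact
  define hom where "hom = \<lparr> iso_verts = \<phi>, iso_arcs = (\<lambda>a. (\<phi> (tail G a), \<phi> (head G a))),
      iso_head = snd, iso_tail = fst \<rparr>"
  have inj: "inj_on \<phi> (verts G)" using \<phi> by (simp add: bij_betw_def)
  have "inj_on (\<lambda>a. (\<phi> (tail G a), \<phi> (head G a))) (arcs G)"
  proof (rule inj_onI)
    fix a b assume ab: "a \<in> arcs G" "b \<in> arcs G"
      "(\<phi> (tail G a), \<phi> (head G a)) = (\<phi> (tail G b), \<phi> (head G b))"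
    then have "arc_to_ends G a = arc_to_ends G b"
      using inj by (auto simp: arc_to_ends_def inj_on_eq_iff)
    then show "a = b" using ab(1,2) no_multi_arcs by blast
  qed
  then have "digraph_isomorphism hom"
    unfolding digraph_isomorphism_def hom_def using inj wf_digraph by simp
  moreover have "(\<lambda>a. (\<phi> (tail G a), \<phi> (head G a))) ` arcs G = parcs H"
  proof (intro Set.set_eqI iffI)
    fix e assume "e \<in> (\<lambda>a. (\<phi> (tail G a), \<phi> (head G a))) ` arcs G"
    then obtain a where a: "a \<in> arcs G" "e = (\<phi> (tail G a), \<phi> (head G a))" by blast
    then have "tail G a \<rightarrow>\<^bsub>G\<^esub> head G a" by (auto simp: arcs_ends_conv)
    with a show "e \<in> parcs H" using adj by auto
  next
    fix e assume e: "e \<in> parcs H"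
    then have "fst e \<in> \<phi> ` verts G" "snd e \<in> \<phi> ` verts G"
      using \<phi> H.arc_fst_in_verts H.arc_snd_in_verts by (auto simp: bij_betw_def)
    then obtain x y where xy: "x \<in> verts G" "y \<in> verts G" "e = (\<phi> x, \<phi> y)" by (cases e) auto
    then have "x \<rightarrow>\<^bsub>G\<^esub> y" using adj e by blast
    then show "e \<in> (\<lambda>a. (\<phi> (tail G a), \<phi> (head G a))) ` arcs G"
      using xy(3) by (auto simp: arcs_ends_conv)
  qed
  then have "with_proj H = app_iso hom G"
    using \<phi> by (simp add: app_iso_def hom_def with_proj_def bij_betw_def)
  ultimately show ?thesis unfolding digraph_iso_def by blast
qed

text \<open>Bijections between fibres of equal size, one for each label, are glued together;
  preserving labels makes the result injective across fibres.\<close>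

lemma bij_betw_over:
  fixes f :: "'a \<Rightarrow> 'k" and g :: "'b \<Rightarrow> 'k"
  assumes "finite A" "finite B"
    and card: "\<And>k. card {a \<in> A. f a = k} = card {b \<in> B. g b = k}"
  obtains \<phi> where "bij_betw \<phi> A B" "\<And>a. a \<in> A \<Longrightarrow> g (\<phi> a) = f a"
proof -
  have "\<exists>\<psi>. bij_betw \<psi> {a \<in> A. f a = k} {b \<in> B. g b = k}" for k
    using assms by (intro finite_same_card_bij) auto
  then obtain \<psi> where \<psi>: "\<And>k. bij_betw (\<psi> k) {a \<in> A. f a = k} {b \<in> B. g b = k}" by metis
  define \<phi> where "\<phi> a = \<psi> (f a) a" for a
  have mem: "\<phi> a \<in> B" "g (\<phi> a) = f a" if "a \<in> A" for a
    using bij_betwE[OF \<psi>[of "f a"]] that by (auto simp: \<phi>_def)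
  have "bij_betw \<phi> A B"
  proof (rule bij_betw_imageI)
    show "inj_on \<phi> A"
    proof (rule inj_onI)
      fix a a' assume a: "a \<in> A" "a' \<in> A" "\<phi> a = \<phi> a'"
      then have "f a = f a'" using mem by metis
      then show "a = a'"
        using bij_betw_imp_inj_on[OF \<psi>[of "f a"]] a by (auto simp: \<phi>_def inj_on_def)
    qed
    show "\<phi> ` A = B"
    proof (intro Set.set_eqI iffI)
      fix b assume "b \<in> B"
      then obtain a where "a \<in> A" "f a = g b" "b = \<psi> (g b) a"
        using bij_betw_imp_surj_on[OF \<psi>[of "g b"]] by (auto simp: set_eq_iff image_iff)
      then show "b \<in> \<phi> ` A" by (auto simp: \<phi>_def intro!: image_eqI[of _ _ a])
    qed (use mem in auto)
  qed
  with mem that show ?thesis by blast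
qed

text \<open>This is the counterpart of \<open>twin\<close> in G(r): the label names the vertex of
  K_{t,s} whose clique contains the given vertex, and the summand of the label records the
  side.\<close>

fun gr_class :: "gr_vertex \<Rightarrow> nat + nat" where
  "gr_class (VertV i) = Inl i"
| "gr_class (ExtraV i k) = Inl i"
| "gr_class (VertW j) = Inr j"
| "gr_class (ExtraW j k) = Inr j"

lemma mem_gr_parts:
  "VertV i \<in> side_V t \<longleftrightarrow> i \<in> {1..t}" "VertW i \<notin> side_V t"
  "ExtraV i k \<notin> side_V t" "ExtraW i k \<notin> side_V t"
  "VertW j \<in> side_W s \<longleftrightarrow> j \<in> {1..s}" "VertV j \<notin> side_W s"
  "ExtraV i k \<notin> side_W s" "ExtraW i k \<notin> side_W s"
  "ExtraV i k \<in> class_V t s r i' \<longleftrightarrow> i = i' \<and> k \<in> {1..size_V t s r}" "VertV i \<notin> class_V t s r i'"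
  "VertW i \<notin> class_V t s r i'" "ExtraW i k \<notin> class_V t s r i'"
  "ExtraW j k \<in> class_W t s r j' \<longleftrightarrow> j = j' \<and> k \<in> {1..size_W t s r}" "VertV j \<notin> class_W t s r j'"
  "VertW j \<notin> class_W t s r j'" "ExtraV j k \<notin> class_W t s r j'"
  by (auto simp: side_V_def side_W_def class_V_def class_W_def)

text \<open>This puts G(r) into the same blow-up form as \<open>closed_adj_twin\<close>; the edge
  list is compared with it for each pair of constructors.\<close>

lemma gr_adj_iff:
  assumes "x \<in> pverts (gr_graph t s r)" "y \<in> pverts (gr_graph t s r)"
  shows "(x, y) \<in> parcs (gr_graph t s r) \<longleftrightarrow>
    x \<noteq> y \<and> (gr_class x = gr_class y \<or> isl (gr_class x) \<noteq> isl (gr_class y))"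
  using assms unfolding gr_graph_def gr_edges_def
  by (cases x; cases y) (simp_all add: mem_gr_parts, (blast | auto)+)

lemma card_gr_class:
  "card {x \<in> pverts (gr_graph t s r). gr_class x = Inl i}
     = (if i \<in> {1..t} then size_V t s r + 1 else 0)"
  "card {x \<in> pverts (gr_graph t s r). gr_class x = Inr i}
     = (if i \<in> {1..s} then size_W t s r + 1 else 0)"
proof -
  have "{x \<in> pverts (gr_graph t s r). gr_class x = Inl i}
      = (if i \<in> {1..t} then insert (VertV i) (class_V t s r i) else {})"
    by (auto simp: gr_graph_def side_V_def side_W_def class_V_def class_W_def)
  moreover have "{x \<in> pverts (gr_graph t s r). gr_class x = Inr i}
      = (if i \<in> {1..s} then insert (VertW i) (class_W t s r i) else {})"
    by (auto simp: gr_graph_def side_V_def side_W_def class_V_def class_W_def)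
  moreover have "card (insert (VertV i) (class_V t s r i)) = size_V t s r + 1"
    "card (insert (VertW i) (class_W t s r i)) = size_W t s r + 1"
    by (subst card_insert_disjoint; auto simp: class_V_def class_W_def card_image inj_on_def)+
  ultimately show "card {x \<in> pverts (gr_graph t s r). gr_class x = Inl i}
     = (if i \<in> {1..t} then size_V t s r + 1 else 0)"
    "card {x \<in> pverts (gr_graph t s r). gr_class x = Inr i}
     = (if i \<in> {1..s} then size_W t s r + 1 else 0)" by auto
qed

section \<open>Class sizes and the congruence\<close>

lemma class_sizes:
  fixes r s t c d :: nat
  assumes ts: "2 \<le> t" "2 \<le> s" and eq: "r + 1 = c + s * d" "r + 1 = d + t * c"
  shows "int c * (int t * int s - 1) = (int r + 1) * (int s - 1)"
    and "int d * (int t * int s - 1) = (int r + 1) * (int t - 1)"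
proof -
  have 1: "int r + 1 = int c + int s * int d" and 2: "int r + 1 = int d + int t * int c"
    using eq by (metis of_nat_1 of_nat_add of_nat_mult)+
  show "int c * (int t * int s - 1) = (int r + 1) * (int s - 1)"
  proof -
    \<comment> \<open>\<open>s\<close> times the second equation minus the first eliminates
      \<open>d\<close>; below, \<open>t\<close> times the first minus the second eliminates
      \<open>c\<close>.\<close>
    have "int c * (int t * int s - 1)
        = int s * (int d + int t * int c) - (int c + int s * int d)" by (simp add: algebra_simps)
    also have "\<dots> = int s * (int r + 1) - (int r + 1)" by (simp only: 1[symmetric] 2[symmetric])
    finally show ?thesis by (simp add: algebra_simps)
  qed
  show "int d * (int t * int s - 1) = (int r + 1) * (int t - 1)"
  proof -
    have "int d * (int t * int s - 1)
        = int t * (int c + int s * int d) - (int d + int t * int c)" by (simp add: algebra_simps)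
    also have "\<dots> = int t * (int r + 1) - (int r + 1)" by (simp only: 1[symmetric] 2[symmetric])
    finally show ?thesis by (simp add: algebra_simps)
  qed
qed

text \<open>Since ts - 1 divides (r + 1)(s - 1) and (r + 1)(t - 1), it divides r + 1 times the gcd
  \<open>g\<close> of s - 1 and t - 1. As \<open>g\<close> itself divides ts - 1 = t(s - 1) + (t -
  1), it can be cancelled.\<close>

lemma congruence_from_sizes:
  fixes r s t c d :: int
  assumes "2 \<le> t" "2 \<le> s"
    and c: "c * (t * s - 1) = (r + 1) * (s - 1)" and d: "d * (t * s - 1) = (r + 1) * (t - 1)"
  shows "[r = -1] (mod ((t * s - 1) div gcd (s - 1) (t - 1)))"
proof -
  define g where "g = gcd (s - 1) (t - 1)"
  have g: "g \<noteq> 0" using assms(1) by (simp add: g_def)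
  have "t * s - 1 dvd gcd ((r + 1) * (s - 1)) ((r + 1) * (t - 1))"
    using c d by (metis dvd_triv_right gcd_greatest)
  also have "gcd ((r + 1) * (s - 1)) ((r + 1) * (t - 1)) = \<bar>(r + 1) * g\<bar>"
    by (simp add: g_def gcd_mult_left abs_mult)
  finally have dvd: "t * s - 1 dvd (r + 1) * g" by simp
  have "t * s - 1 = t * (s - 1) + (t - 1)" by (simp add: algebra_simps)
  then have "g dvd t * s - 1" unfolding g_def by (metis dvd_add dvd_mult gcd_dvd1 gcd_dvd2)
  then obtain m where m: "t * s - 1 = g * m" ..
  have "m dvd r + 1" using dvd g unfolding m by (simp add: mult.commute)
  then show ?thesis using g by (simp add: g_def[symmetric] m cong_iff_dvd_diff)
qed

context bipartite_star_complement
begin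

lemma regularity_congruence:
  "[int r = -1] (mod ((int t * int s - 1) div gcd (int s - 1) (int t - 1)))"
proof -
  obtain c d where "\<And>p. p \<in> P \<Longrightarrow> fibre p = c" "\<And>q. q \<in> Q \<Longrightarrow> fibre q = d"
    and cd: "r + 1 = c + s * d" "r + 1 = d + t * c" by (rule fibre_const) (rule that)
  from class_sizes[OF ts cd] show ?thesis using ts by (intro congruence_from_sizes) auto
qed

lemma fibre_sizes:
  "p \<in> P \<Longrightarrow> fibre p = size_V t s r + 1"
  "q \<in> Q \<Longrightarrow> fibre q = size_W t s r + 1"
proof -
  obtain c d where cd: "\<And>p. p \<in> P \<Longrightarrow> fibre p = c" "\<And>q. q \<in> Q \<Longrightarrow> fibre q = d"
    "r + 1 = c + s * d" "r + 1 = d + t * c" "c > 0" "d > 0" by (rule fibre_const) (rule that)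
  have ge: "t * s - 1 > 0" using mult_le_mono[OF ts] by simp
  have le: "1 \<le> t * s" "1 \<le> t" "1 \<le> s" using ge ts by auto
  have cast: "int (t * s - 1) = int t * int s - 1" "int (t - 1) = int t - 1" "int (s - 1) = int s - 1"
    using le by (simp_all only: of_nat_diff of_nat_mult of_nat_1)
  have "int (c * (t * s - 1)) = int ((r + 1) * (s - 1))" "int (d * (t * s - 1)) = int ((r + 1) * (t - 1))"
    using class_sizes[OF ts cd(3,4)] unfolding of_nat_mult cast by (simp_all add: add.commute)
  then have "(r + 1) * (s - 1) = c * (t * s - 1)" "(r + 1) * (t - 1) = d * (t * s - 1)"
    by (simp_all only: of_nat_eq_iff)
  \<comment> \<open>The divisions are exact with quotients \<open>c\<close> and \<open>d\<close>.
    The fibres count v_i or w_j as well, which accounts for the 1 subtracted.\<close>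
  then have "size_V t s r = c - 1" "size_W t s r = d - 1"
    using ge unfolding size_V_def size_W_def by simp_all
  then show "p \<in> P \<Longrightarrow> fibre p = size_V t s r + 1" "q \<in> Q \<Longrightarrow> fibre q = size_W t s r + 1"
    using cd by simp_all
qed

lemma iso_gr_graph: "digraph_iso G (with_proj (gr_graph t s r))"
proof -
  obtain eP where eP: "bij_betw eP P {1..t}"
    using finite_same_card_bij[of P "{1..t}"] finite_parts card_parts by auto
  obtain eQ where eQ: "bij_betw eQ Q {1..s}"
    using finite_same_card_bij[of Q "{1..s}"] finite_parts card_parts by auto
  \<comment> \<open>\<open>e\<close> names the vertices of the star complement by the labels of
    \<open>gr_class\<close>, so \<open>e (twin x)\<close> plays the role of \<open>gr_class\<close>
    on the given graph.\<close>
  define e where "e h = (if h \<in> P then Inl (eP h) else Inr (eQ h))" for h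
  have e_inj: "e h = e h' \<longleftrightarrow> h = h'" if "h \<in> P \<union> Q" "h' \<in> P \<union> Q" for h h'
    using that bij_betw_imp_inj_on[OF eP] bij_betw_imp_inj_on[OF eQ]
    by (auto simp: e_def inj_on_eq_iff)
  have e_im: "e ` (P \<union> Q) = Inl ` {1..t} \<union> Inr ` {1..s}"
  proof -
    have "e ` P = Inl ` eP ` P" by (auto simp: e_def)
    moreover have "e ` Q = Inr ` eQ ` Q" using parts(2) by (auto simp: e_def image_iff)
    ultimately show ?thesis
      using bij_betw_imp_surj_on[OF eP] bij_betw_imp_surj_on[OF eQ] by (simp add: image_Un)
  qed
  \<comment> \<open>Gluing needs equal fibres for every label \<open>k\<close>: labels of the star
    complement are settled by \<open>fibre_sizes\<close>, and all others have empty fibres on both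
    sides.\<close>
  have card: "card {x \<in> verts G. e (twin x) = k} = card {y \<in> pverts (gr_graph t s r). gr_class y = k}" for k
  proof (cases "k \<in> e ` (P \<union> Q)")
    case True
    then obtain h where h: "h \<in> P \<union> Q" "k = e h" by blast
    have "{x \<in> verts G. e (twin x) = k} = {x \<in> verts G. twin x = h}"
      using twin(1) h e_inj by auto
    then have "card {x \<in> verts G. e (twin x) = k} = fibre h" by (simp add: fibre_def)
    also have "\<dots> = card {y \<in> pverts (gr_graph t s r). gr_class y = k}"
    proof (cases "h \<in> P")
      case True
      then have "k = Inl (eP h)" "eP h \<in> {1..t}" using h bij_betwE[OF eP] by (auto simp: e_def)
      then show ?thesis using fibre_sizes(1)[OF True] by (simp add: card_gr_class)
    next
      case False
      then have "h \<in> Q" using h by blast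
      moreover have "k = Inr (eQ h)" "eQ h \<in> {1..s}"
        using False \<open>h \<in> Q\<close> h bij_betwE[OF eQ] by (auto simp: e_def)
      ultimately show ?thesis using fibre_sizes(2) by (simp add: card_gr_class)
    qed
    finally show ?thesis .
  next
    case False
    then have "{x \<in> verts G. e (twin x) = k} = {}" using twin(1) by blast
    moreover have "card {y \<in> pverts (gr_graph t s r). gr_class y = k} = 0"
      using False unfolding e_im by (cases k) (auto simp: card_gr_class)
    ultimately show ?thesis by simp
  qed
  obtain \<phi> where \<phi>: "bij_betw \<phi> (verts G) (pverts (gr_graph t s r))"
    and gr_class_\<phi>: "\<And>x. x \<in> verts G \<Longrightarrow> gr_class (\<phi> x) = e (twin x)"
    using bij_betw_over[OF finite_verts finite_gr_vertices card] by metis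
  \<comment> \<open>For distinct vertices, adjacency depends on the labels alone in both graphs and
    by the same rule, so a label-preserving bijection respects it.\<close>
  have "x \<rightarrow>\<^bsub>G\<^esub> y \<longleftrightarrow> (\<phi> x, \<phi> y) \<in> parcs (gr_graph t s r)" if xy: "x \<in> verts G" "y \<in> verts G" for x y
  proof -
    have side: "isl (e h) \<longleftrightarrow> h \<in> P" for h by (simp add: e_def)
    have "x \<rightarrow>\<^bsub>G\<^esub> y \<longleftrightarrow> x \<noteq> y \<and> closed_adj G x y"
      using adj_not_same by (auto simp: closed_adj_def)
    also have "\<dots> \<longleftrightarrow> x \<noteq> y \<and> (twin x = twin y \<or> (twin x \<in> P) \<noteq> (twin y \<in> P))"
      using closed_adj_twin[OF xy] twin(1)[OF xy(2)] parts(2) by auto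
    also have "\<dots> \<longleftrightarrow> \<phi> x \<noteq> \<phi> y \<and>
        (gr_class (\<phi> x) = gr_class (\<phi> y) \<or> isl (gr_class (\<phi> x)) \<noteq> isl (gr_class (\<phi> y)))"
      using xy bij_betw_imp_inj_on[OF \<phi>] twin(1) by (auto simp: gr_class_\<phi> side e_inj inj_on_eq_iff)
    also have "\<dots> \<longleftrightarrow> (\<phi> x, \<phi> y) \<in> parcs (gr_graph t s r)"
      using xy bij_betwE[OF \<phi>] by (subst gr_adj_iff) auto
    finally show ?thesis .
  qed
  then show ?thesis
    using pair_graph_gr_graph[of t s r] \<phi>
    by (intro digraph_iso_with_projI nomulti_digraph)
      (auto simp: pair_graph_def pair_digraph_def pair_fin_digraph_def)
qed

end

theorem theorem3p5:
  fixes G :: "('a, 'b) pre_digraph" and s t r :: nat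
  assumes "2 \<le> t" and "t \<le> s"
    and "graph G"
    and "regular_graph r G"
    and "has_bipartite_star_complement G t s (-1)"
  shows "[int r = -1] (mod ((int t * int s - 1) div gcd (int s - 1) (int t - 1)))
         \<and> digraph_iso G (with_proj (gr_graph t s r))"
proof -
  interpret graph G by fact
  obtain X P Q where star: "star_set G (-1) X"
    and K: "verts G - X = P \<union> Q" "P \<inter> Q = {}" "card P = t" "card Q = s"
      "arcs_ends (G \<restriction> (verts G - X)) = P \<times> Q \<union> Q \<times> P"
    using assms(5) unfolding has_bipartite_star_complement_def complete_bipartite_digraph_def by auto
  have "arcs_ends G \<inter> (P \<union> Q) \<times> (P \<union> Q) = P \<times> Q \<union> Q \<times> P"
    using K(5) unfolding arcs_ends_induce_subgraph K(1) .
  then interpret bipartite_star_complement G r t s X P Q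
    using assms star K by unfold_locales auto
  show ?thesis using regularity_congruence iso_gr_graph by blast
qed

end
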